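(* The power series expansions of every holomorphic function in its C-representation and in its H-representation are similar and converge with identical radii of convergence $R$. That is, if the C-representation $\psi_C(\xi)$ of a holomorphic function has the expansion $\psi_C(\xi)=\sum_{l=0}^\infty r_l\xi^l$, $r_l\in\mathbb{R}$, with radius of convergence $R$, then its H-representation $\psi_H(p)$ has the expansion $\psi_H(p)=\sum_{l=0}^\infty r_l p^l$ (with the same coefficients of the terms of the same degrees), with the same radius of convergence $R$; in the C-representation $R$ is regarded as the radius of the convergence disk $D(0,R)=\{\xi\in\mathbb{C}:|\xi|<R\}$, and in the H-representation as the radius of the corresponding convergence ball $B(0,R)=\{p\in\mathbb{H}:|p|<R\}$.
   Context: $\mathbb{H}$ is the algebra of quaternions; $p=x+yi+zj+uk\in\mathbb{H}$ with $x,y,z,u\in\mathbb{R}$, and $|p|=\sqrt{x^2+y^2+z^2+u^2}$. C-holomorphic means holomorphic in the usual complex sense. H-holomorphic. Write $p=a+b\cdot j$ with $a=x+yi$, $b=z+ui$, $\overline a=x-yi$, $\overline b=z-ui$, and a quaternionic function as $\psi(p)=\Phi_1+\Phi_2\cdot j$ with $\Phi_1,\Phi_2$ complex-valued functions of $a,b,\overline a,\overline b$ having continuous first-order partial derivatives in an open connected neighborhood $G_4$ of $p$ (Wirtinger derivatives $\partial_a,\partial_{\overline a},\partial_b,\partial_{\overline b}$). $\psi$ is H-holomorphic at $p$ iff in $G_4$: $(\partial_a\Phi_1| = (\partial_{\overline b}\overline{\Phi_2}|$, $(\partial_a\Phi_2| = -(\partial_{\overline b}\overline{\Phi_1}|$,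 $(\partial_a\Phi_1| = (\partial_b\Phi_2|$, $(\partial_{\overline a}\Phi_2| = -(\partial_{\overline b}\Phi_1|$, where $(\cdots|$ means that after differentiation one sets $a=\overline a=x$ (i.e. $y=0$). C- and H-representations. A C-holomorphic function $\psi_C(\xi)$ on an open connected set $G_2\subseteq\mathbb{C}$ is called the C-representation of a holomorphic function; its H-representation is the H-holomorphic function $\psi_H(p)$ "of the same kind", obtained by replacing the complex variable $\xi\in G_2$ in the expression for $\psi_C(\xi)$ by the quaternionic variable $p\in G_4\subseteq\mathbb{H}$, where $G_4\supset G_2$ is such that $G_2$ follows exactly from $G_4$ upon the transition from $p$ to $\xi$. Here $G_2$ is regarded as a disk $D(0,R)$ and $G_4$ as a ball $B(0,R)$; functions with singularities are not considered. Quaternionic power series are series $\sum_{l=0}^\infty r_l p^l$ with real coefficients $r_l$, and convergence means convergence of the sequence of partial sums. *)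

theory Defs
  imports "HOL-Analysis.Analysis"
begin

section \<open>Quaternions\<close>

text \<open>\<open>Quat x y z u\<close> is the quaternion \<open>x + y i + z j + u k\<close>.\<close>

datatype quat = Quat (qRe: real) (qI: real) (qJ: real) (qK: real)

lemma quat_eq_iff: "p = q \<longleftrightarrow> qRe p = qRe q \<and> qI p = qI q \<and> qJ p = qJ q \<and> qK p = qK q"
  by (cases p; cases q) auto

instantiation quat :: ring_1
begin

definition "0 = Quat 0 0 0 0"
definition "1 = Quat 1 0 0 0"
definition "p + q = Quat (qRe p + qRe q) (qI p + qI q) (qJ p + qJ q) (qK p + qK q)"
definition "p - q = Quat (qRe p - qRe q) (qI p - qI q) (qJ p - qJ q) (qK p - qK q)"
definition "- p = Quat (- qRe p) (- qI p) (- qJ p) (- qK p)"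
definition "p * q = Quat
  (qRe p * qRe q - qI p * qI q - qJ p * qJ q - qK p * qK q)
  (qRe p * qI q + qI p * qRe q + qJ p * qK q - qK p * qJ q)
  (qRe p * qJ q - qI p * qK q + qJ p * qRe q + qK p * qI q)
  (qRe p * qK q + qI p * qJ q - qJ p * qI q + qK p * qRe q)"

instance
  by standard
    (simp_all add: quat_eq_iff zero_quat_def one_quat_def plus_quat_def minus_quat_def
      uminus_quat_def times_quat_def algebra_simps)

end

instantiation quat :: real_vector
begin

definition "scaleR r p = Quat (r * qRe p) (r * qI p) (r * qJ p) (r * qK p)"

instance
  by standard
    (simp_all add: quat_eq_iff scaleR_quat_def plus_quat_def algebra_simps)

end

instantiation quat :: real_inner
begin

definition "inner p q = qRe p * qRe q + qI p * qI q + qJ p * qJ q + qK p * qK q"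
definition "norm p = sqrt ((qRe p)\<^sup>2 + (qI p)\<^sup>2 + (qJ p)\<^sup>2 + (qK p)\<^sup>2)"
definition "sgn (p::quat) = p /\<^sub>R norm p"
definition "dist (p::quat) q = norm (p - q)"
definition [code del]:
  "(uniformity :: (quat \<times> quat) filter) = (INF e\<in>{0<..}. principal {(p, q). dist p q < e})"
definition [code del]:
  "open (U :: quat set) \<longleftrightarrow> (\<forall>p\<in>U. eventually (\<lambda>(p', q). p' = p \<longrightarrow> q \<in> U) uniformity)"

instance
proof
  fix p q s :: quat and a b :: real
  show "inner p p = 0 \<longleftrightarrow> p = 0"
  proof
    assume "inner p p = 0"
    then have *: "(qRe p)\<^sup>2 + (qI p)\<^sup>2 + (qJ p)\<^sup>2 + (qK p)\<^sup>2 = 0"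
      by (simp add: inner_quat_def power2_eq_square)
    have "(qRe p)\<^sup>2 \<ge> 0" "(qI p)\<^sup>2 \<ge> 0" "(qJ p)\<^sup>2 \<ge> 0" "(qK p)\<^sup>2 \<ge> 0"
      by simp_all
    with * have "(qRe p)\<^sup>2 = 0" "(qI p)\<^sup>2 = 0" "(qJ p)\<^sup>2 = 0" "(qK p)\<^sup>2 = 0"
      by linarith+
    then show "p = 0"
      by (simp add: quat_eq_iff zero_quat_def)
  qed (simp add: inner_quat_def zero_quat_def)
qed (simp_all add: quat_eq_iff scaleR_quat_def inner_quat_def norm_quat_def sgn_quat_def
      dist_quat_def uniformity_quat_def open_quat_def plus_quat_def algebra_simps
      power2_eq_square)

end

lemma quat_norm_mult: "norm (p * q) = norm p * norm (q :: quat)"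
  by (simp add: norm_quat_def times_quat_def flip: real_sqrt_mult)
    (simp add: power2_eq_square algebra_simps)

instantiation quat :: real_normed_div_algebra
begin

text \<open>The inverse is the conjugate divided by the squared norm.\<close>

definition "inverse p = Quat (qRe p) (- qI p) (- qJ p) (- qK p) /\<^sub>R (norm p)\<^sup>2"
definition "(p::quat) div q = p * inverse q"

instance
proof
  fix p q :: quat and a :: real
  have norm2: "(norm p)\<^sup>2 = (qRe p)\<^sup>2 + (qI p)\<^sup>2 + (qJ p)\<^sup>2 + (qK p)\<^sup>2"
    by (simp add: norm_quat_def)
  show "a *\<^sub>R p * q = a *\<^sub>R (p * q)" "p * a *\<^sub>R q = a *\<^sub>R (p * q)"
    by (simp_all add: quat_eq_iff scaleR_quat_def times_quat_def algebra_simps)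
  show "inverse (0::quat) = 0"
    by (simp add: inverse_quat_def zero_quat_def scaleR_quat_def)
  show "p div q = p * inverse q"
    by (rule divide_quat_def)
  show "norm (p * q) = norm p * norm q"
    by (rule quat_norm_mult)
  assume "p \<noteq> 0"
  define c where "c = inverse ((norm p)\<^sup>2)"
  have inv: "inverse p = Quat (c * qRe p) (- (c * qI p)) (- (c * qJ p)) (- (c * qK p))"
    by (simp add: inverse_quat_def scaleR_quat_def c_def)
  have c: "c * ((qRe p)\<^sup>2 + (qI p)\<^sup>2 + (qJ p)\<^sup>2 + (qK p)\<^sup>2) = 1"
    using \<open>p \<noteq> 0\<close> by (simp add: c_def flip: norm2)
  show "inverse p * p = 1" "p * inverse p = 1"
    using c by (simp_all add: inv times_quat_def one_quat_def power2_eq_square algebra_simps)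
qed

end

definition quat_of_complex :: "complex \<Rightarrow> quat" where
  "quat_of_complex \<xi> = Quat (Re \<xi>) (Im \<xi>) 0 0"

text \<open>
  \<open>\<psi> = \<Phi>\<^sub>1 + \<Phi>\<^sub>2 \<cdot> j\<close>; note \<open>(z + u i) \<cdot> j = z j + u k\<close>.
\<close>

definition Phi1 :: "(quat \<Rightarrow> quat) \<Rightarrow> quat \<Rightarrow> complex" where
  "Phi1 \<psi> p = Complex (qRe (\<psi> p)) (qI (\<psi> p))"

definition Phi2 :: "(quat \<Rightarrow> quat) \<Rightarrow> quat \<Rightarrow> complex" where
  "Phi2 \<psi> p = Complex (qJ (\<psi> p)) (qK (\<psi> p))"


section \<open>H-holomorphic functions\<close>

definition partial :: "quat \<Rightarrow> (quat \<Rightarrow> complex) \<Rightarrow> quat \<Rightarrow> complex" where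
  "partial e f p = vector_derivative (\<lambda>t. f (p + t *\<^sub>R e)) (at 0)"

abbreviation "d_x \<equiv> partial (Quat 1 0 0 0)"
abbreviation "d_y \<equiv> partial (Quat 0 1 0 0)"
abbreviation "d_z \<equiv> partial (Quat 0 0 1 0)"
abbreviation "d_u \<equiv> partial (Quat 0 0 0 1)"

definition C1_on :: "(quat \<Rightarrow> complex) \<Rightarrow> quat set \<Rightarrow> bool" where
  "C1_on f G \<longleftrightarrow> (\<forall>e \<in> {Quat 1 0 0 0, Quat 0 1 0 0, Quat 0 0 1 0, Quat 0 0 0 1}.
     (\<forall>p\<in>G. (\<lambda>t. f (p + t *\<^sub>R e)) differentiable (at 0)) \<and> continuous_on G (partial e f))"

text \<open>
  Wirtinger derivatives with respect to \<open>a = x + y i\<close>, \<open>b = z + u i\<close> and their conjugates.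
\<close>

definition d_a :: "(quat \<Rightarrow> complex) \<Rightarrow> quat \<Rightarrow> complex" where
  "d_a f p = (d_x f p - \<i> * d_y f p) / 2"

definition d_abar :: "(quat \<Rightarrow> complex) \<Rightarrow> quat \<Rightarrow> complex" where
  "d_abar f p = (d_x f p + \<i> * d_y f p) / 2"

definition d_b :: "(quat \<Rightarrow> complex) \<Rightarrow> quat \<Rightarrow> complex" where
  "d_b f p = (d_z f p - \<i> * d_u f p) / 2"

definition d_bbar :: "(quat \<Rightarrow> complex) \<Rightarrow> quat \<Rightarrow> complex" where
  "d_bbar f p = (d_z f p + \<i> * d_u f p) / 2"

text \<open>
  The derivatives are taken in all four real variables; only afterwards is \<open>y = 0\<close> set.
  Hence the four equations are required at the points of \<open>G\<close> with \<open>qI p = 0\<close>.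
\<close>

definition H_holomorphic_on :: "(quat \<Rightarrow> quat) \<Rightarrow> quat set \<Rightarrow> bool" where
  "H_holomorphic_on \<psi> G \<longleftrightarrow>
     open G \<and> connected G \<and> C1_on (Phi1 \<psi>) G \<and> C1_on (Phi2 \<psi>) G \<and>
     (\<forall>p\<in>G. qI p = 0 \<longrightarrow>
        d_a (Phi1 \<psi>) p = d_bbar (\<lambda>q. cnj (Phi2 \<psi> q)) p \<and>
        d_a (Phi2 \<psi>) p = - d_bbar (\<lambda>q. cnj (Phi1 \<psi> q)) p \<and>
        d_a (Phi1 \<psi>) p = d_b (Phi2 \<psi>) p \<and>
        d_abar (Phi2 \<psi>) p = - d_bbar (Phi1 \<psi>) p)"


section \<open>C-representation and H-representation\<close>

text \<open>
  Expressions in one variable with real constants.  They can be evaluated in any real normed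
  division algebra, so that replacing the complex variable by a quaternionic one is evaluation
  of the same expression at another type.  The limit constructor accommodates series, infinite
  products and hence the transcendental functions.
\<close>

datatype expr =
    Var
  | Const real
  | Plus expr expr
  | Times expr expr
  | Recip expr
  | Compose expr expr
  | Limit "nat \<Rightarrow> expr"

primrec eval_expr :: "expr \<Rightarrow> 'a::real_normed_div_algebra \<Rightarrow> 'a" where
  "eval_expr Var = (\<lambda>x. x)"
| "eval_expr (Const c) = (\<lambda>x. of_real c)"
| "eval_expr (Plus e f) = (\<lambda>x. eval_expr e x + eval_expr f x)"
| "eval_expr (Times e f) = (\<lambda>x. eval_expr e x * eval_expr f x)"
| "eval_expr (Recip e) = (\<lambda>x. inverse (eval_expr e x))"
| "eval_expr (Compose e f) = (\<lambda>x. eval_expr e (eval_expr f x))"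
| "eval_expr (Limit s) = (\<lambda>x. lim (\<lambda>n. eval_expr (s n) x))"

text \<open>
  The expression is meaningful, without singularities, at all points of \<open>S\<close>; limits are
  uniform on compact subsets.
\<close>

primrec defined_on :: "expr \<Rightarrow> 'a::real_normed_div_algebra set \<Rightarrow> bool" where
  "defined_on Var S \<longleftrightarrow> True"
| "defined_on (Const c) S \<longleftrightarrow> True"
| "defined_on (Plus e f) S \<longleftrightarrow> defined_on e S \<and> defined_on f S"
| "defined_on (Times e f) S \<longleftrightarrow> defined_on e S \<and> defined_on f S"
| "defined_on (Recip e) S \<longleftrightarrow> defined_on e S \<and> (\<forall>x\<in>S. eval_expr e x \<noteq> 0)"
| "defined_on (Compose e f) S \<longleftrightarrow>
     defined_on f S \<and> (\<exists>T. open T \<and> eval_expr f ` S \<subseteq> T \<and> defined_on e T)"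
| "defined_on (Limit s) S \<longleftrightarrow>
     (\<forall>n. defined_on (s n) S) \<and>
     (\<forall>K. compact K \<and> K \<subseteq> S \<longrightarrow>
        uniform_limit K (\<lambda>n. eval_expr (s n)) (eval_expr (Limit s)) sequentially)"

text \<open>
  \<open>\<psi>H\<close> on \<open>G4\<close> is the H-representation of the holomorphic function whose C-representation is
  \<open>\<psi>C\<close> on \<open>G2\<close>.  The set \<open>G2\<close> is what remains of \<open>G4\<close> when \<open>p\<close> is specialised to a complex
  number.
\<close>

definition H_representation ::
  "complex set \<Rightarrow> (complex \<Rightarrow> complex) \<Rightarrow> quat set \<Rightarrow> (quat \<Rightarrow> quat) \<Rightarrow> bool" where
  "H_representation G2 \<psi>C G4 \<psi>H \<longleftrightarrow>
     open G2 \<and> connected G2 \<and> \<psi>C holomorphic_on G2 \<and>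
     H_holomorphic_on \<psi>H G4 \<and>
     G2 = {\<xi>. quat_of_complex \<xi> \<in> G4} \<and>
     (\<exists>e. defined_on e G2 \<and> defined_on e G4 \<and>
        (\<forall>\<xi>\<in>G2. \<psi>C \<xi> = eval_expr e \<xi>) \<and> (\<forall>p\<in>G4. \<psi>H p = eval_expr e p))"


section \<open>Radius of convergence of a quaternionic power series\<close>

text \<open>
  The library's \<^const>\<open>conv_radius\<close> sees only the norms of the coefficients, so it would not
  distinguish the quaternionic series from the complex one.  The radius is therefore defined
  through convergence of the quaternionic partial sums.
\<close>

definition quat_conv_radius :: "(nat \<Rightarrow> real) \<Rightarrow> ereal" where
  "quat_conv_radius r = Sup {ereal (norm p) | p::quat. summable (\<lambda>l. of_real (r l) * p ^ l)}"

end

theory Submission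
  imports Defs
begin

text \<open>
  Every quaternion lies in a slice \<open>\<real> + \<real> v\<close> with \<open>v\<^sup>2 = -1\<close>, and \<open>x + y i \<mapsto> x + y v\<close> is an isometric
  embedding of the algebra \<open>\<complex>\<close> onto that slice.  Evaluation of an expression commutes with
  continuous unital homomorphisms, so \<open>\<psi>H\<close> on the slice is the image of \<open>\<psi>C\<close>, and the quaternionic
  power series there is the image of the complex one; neither values nor convergence change.
\<close>

locale real_div_algebra_hom = bounded_linear \<phi>
  for \<phi> :: "'a::real_normed_div_algebra \<Rightarrow> 'b::real_normed_div_algebra" +
  assumes hom_mult: "\<phi> (x * y) = \<phi> x * \<phi> y"
    and hom_one: "\<phi> 1 = 1"
begin

lemma hom_of_real: "\<phi> (of_real c) = of_real c"
  by (simp add: of_real_def scaleR hom_one)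

lemma hom_power: "\<phi> (x ^ n) = \<phi> x ^ n"
  by (induction n) (simp_all add: hom_mult hom_one)

lemma hom_inverse: "\<phi> (inverse x) = inverse (\<phi> x)"
proof (cases "x = 0")
  case False
  then have "\<phi> x * \<phi> (inverse x) = 1"
    by (simp add: hom_one flip: hom_mult)
  then show ?thesis
    by (metis inverse_unique)
\<comment> \<open>The case \<open>x = 0\<close> rests on the convention \<open>inverse 0 = 0\<close>
  on both sides.\<close>
qed (simp add: zero)

text \<open>Induction on the expression. \<open>S\<close> must vary because in
  \<open>Compose\<close> the outer expression is defined on another set \<open>T\<close>. In
  \<open>Limit\<close>, \<open>lim\<close> is meaningful only for convergent sequences: convergence
  is known at \<open>x\<close>, and continuity of \<open>\<phi>\<close> carries it to
  \<open>\<phi> x\<close>.\<close>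

lemma hom_eval_expr:
  assumes "defined_on e S" "x \<in> S"
  shows "eval_expr e (\<phi> x) = \<phi> (eval_expr e x)"
  using assms
proof (induction e arbitrary: S x)
  case (Compose e f)
  then obtain T where "eval_expr f ` S \<subseteq> T" "defined_on e T" "defined_on f S"
    by auto
  with Compose show ?case
    by (metis eval_expr.simps(6) image_subset_iff)
next
  case (Limit s)
  \<comment> \<open>Singletons are compact, so uniform convergence on compact sets yields the
    pointwise limit.\<close>
  have "uniform_limit {x} (\<lambda>n. eval_expr (s n)) (eval_expr (Limit s)) sequentially"
    using Limit.prems unfolding defined_on.simps
    by (meson compact_sing empty_subsetI insert_subset)
  then have "(\<lambda>n. eval_expr (s n) x) \<longlonglongrightarrow> eval_expr (Limit s) x"
    by (rule tendsto_uniform_limitI) (rule singletonI)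
  then have "(\<lambda>n. \<phi> (eval_expr (s n) x)) \<longlonglongrightarrow> \<phi> (eval_expr (Limit s) x)"
    by (rule tendsto)
  moreover have "eval_expr (s n) (\<phi> x) = \<phi> (eval_expr (s n) x)" for n
    using Limit.prems by (intro Limit.IH[of _ S]) auto
  ultimately show ?case
    by (simp add: limI)
qed (auto simp: add hom_mult hom_of_real hom_inverse)

end

definition slice :: "quat \<Rightarrow> complex \<Rightarrow> quat" where
  "slice v \<xi> = of_real (Re \<xi>) + Im \<xi> *\<^sub>R v"

lemma bounded_linear_slice: "bounded_linear (slice v)"
  unfolding slice_def[abs_def]
  by (intro bounded_linear_add bounded_linear_compose[OF bounded_linear_of_real]
      bounded_linear_compose[OF bounded_linear_scaleR_left] bounded_linear_Re bounded_linear_Im)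

lemma real_div_algebra_hom_slice:
  assumes "v * v = -1"
  shows "real_div_algebra_hom (slice v)"
proof -
  interpret bounded_linear "slice v"
    by (rule bounded_linear_slice)
  show ?thesis
    by unfold_locales
      (simp_all add: slice_def assms of_real_def algebra_simps)
qed

text \<open>\<open>v\<close> is the normalised imaginary part of \<open>p\<close>, and
  \<open>\<xi>\<close> has the real part of \<open>p\<close> and the length \<open>s\<close> of its
  imaginary part. A purely imaginary unit quaternion squares to -1.\<close>

lemma exists_slice:
  obtains v \<xi> where "v * v = -1" "qRe v = 0" "norm v = 1" "p = slice v \<xi>" "norm \<xi> = norm p"
proof (cases p)
  case (Quat x y z u)
  define s where "s = sqrt (y\<^sup>2 + z\<^sup>2 + u\<^sup>2)"
  have s2: "s * s = y * y + z * z + u * u"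
    by (simp add: s_def power2_eq_square)
  \<comment> \<open>A real \<open>p\<close> lies in every slice; the unit i is then an arbitrary
    choice.\<close>
  define v where "v = (if s = 0 then Quat 0 1 0 0 else Quat 0 (y / s) (z / s) (u / s))"
  have zero: "y = 0 \<and> z = 0 \<and> u = 0" if "s = 0"
    using that s2 by (smt (verit) mult_eq_0_iff zero_le_square)
  have "y / s * (y / s) + z / s * (z / s) + u / s * (u / s) = 1" if "s \<noteq> 0"
    using that by (simp add: add_divide_distrib[symmetric] flip: s2)
  then have "v * v = -1" "norm v = 1"
    by (auto simp: v_def times_quat_def uminus_quat_def one_quat_def norm_quat_def
        power2_eq_square)
  moreover have "p = slice v (Complex x s)"
    using Quat zero
    by (auto simp: slice_def v_def of_real_def one_quat_def scaleR_quat_def plus_quat_def)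
  moreover have "norm (Complex x s) = norm p"
    using Quat by (simp add: norm_quat_def cmod_def s_def)
  ultimately show ?thesis
    using that by (simp add: v_def)
qed

text \<open>The hypotheses make 1 and \<open>v\<close> orthonormal, so taking inner products with
  them is a bounded linear left inverse of \<open>slice v\<close>. Hence summability is reflected as
  well as preserved.\<close>

lemma summable_slice_iff:
  assumes "qRe v = 0" "norm v = 1"
  shows "summable (\<lambda>n. slice v (f n)) \<longleftrightarrow> summable f"
proof
  have coords: "bounded_linear (\<lambda>p::quat. Complex (p \<bullet> 1) (p \<bullet> v))"
    unfolding Complex_eq
    by (intro bounded_linear_add bounded_linear_compose[OF bounded_linear_of_real]
        bounded_linear_compose[OF bounded_linear_mult_right] bounded_linear_inner_left)
  have "v \<bullet> 1 = 0" "1 \<bullet> v = 0"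
    using assms(1) by (simp_all add: inner_quat_def one_quat_def)
  moreover have "v \<bullet> v = 1" "(1::quat) \<bullet> 1 = 1"
    using assms(2) by (simp_all add: dot_square_norm)
  ultimately have inverse: "Complex (slice v \<xi> \<bullet> 1) (slice v \<xi> \<bullet> v) = \<xi>" for \<xi>
    by (simp add: slice_def of_real_def inner_add_left)
  assume "summable (\<lambda>n. slice v (f n))"
  from bounded_linear.summable[OF coords this] show "summable f"
    by (simp add: inverse)
next
  assume "summable f"
  then show "summable (\<lambda>n. slice v (f n))"
    by (rule bounded_linear.summable[OF bounded_linear_slice])
qed

lemma slice_power_series_term:
  assumes "v * v = -1"
  shows "slice v (of_real c * \<xi> ^ n) = of_real c * slice v \<xi> ^ n"
proof -
  interpret real_div_algebra_hom "slice v"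
    using assms by (rule real_div_algebra_hom_slice)
  show ?thesis
    by (simp add: hom_mult hom_of_real hom_power)
qed

lemma summable_quat_power_series_iff:
  fixes p :: quat and r :: "nat \<Rightarrow> real"
  obtains \<xi> :: complex where "norm \<xi> = norm p"
    "summable (\<lambda>l. of_real (r l) * p ^ l) \<longleftrightarrow> summable (\<lambda>l. of_real (r l) * \<xi> ^ l)"
proof -
  obtain v \<xi> where v: "v * v = -1" "qRe v = 0" "norm v = 1"
    and p: "p = slice v \<xi>" "norm \<xi> = norm p"
    by (rule exists_slice)
  show ?thesis
    using summable_slice_iff[OF v(2,3), of "\<lambda>l. of_real (r l) * \<xi> ^ l"] p
    by (intro that[of \<xi>]) (simp_all add: slice_power_series_term[OF v(1)])
qed

text \<open>Passing from \<open>p\<close> to a complex number of equal norm bounds the supremum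
  above; for the lower bound, real quaternions already attain every norm below the complex
  radius.\<close>

lemma quat_conv_radius_eq_conv_radius:
  "quat_conv_radius r = conv_radius (\<lambda>l. complex_of_real (r l))"
proof (rule antisym)
  show "quat_conv_radius r \<le> conv_radius (\<lambda>l. complex_of_real (r l))"
    unfolding quat_conv_radius_def
  proof (rule Sup_least, clarify)
    fix p :: quat
    assume p: "summable (\<lambda>l. of_real (r l) * p ^ l)"
    obtain \<xi> :: complex where "norm \<xi> = norm p" "summable (\<lambda>l. of_real (r l) * \<xi> ^ l)"
      using summable_quat_power_series_iff[of p r] p by metis
    then show "ereal (norm p) \<le> conv_radius (\<lambda>l. complex_of_real (r l))"
      using conv_radius_geI by metis
  qed
  have summable_p: "summable (\<lambda>l. of_real (r l) * p ^ l)"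
    if "ereal (norm p) < conv_radius (\<lambda>l. complex_of_real (r l))" for p :: quat
  proof -
    obtain \<xi> :: complex where \<xi>: "norm \<xi> = norm p"
      "summable (\<lambda>l. of_real (r l) * p ^ l) \<longleftrightarrow> summable (\<lambda>l. of_real (r l) * \<xi> ^ l)"
      by (rule summable_quat_power_series_iff)
    show ?thesis
      unfolding \<xi>(2) by (rule summable_in_conv_radius) (simp add: \<xi>(1) that)
  qed
  have le: "ereal (norm p) \<le> quat_conv_radius r"
    if "summable (\<lambda>l. of_real (r l) * p ^ l)" for p :: quat
    unfolding quat_conv_radius_def using that by (intro Sup_upper) auto
  \<comment> \<open>Convergence at 0 makes the supremum nonnegative, which excludes a negative
    \<open>c\<close> below.\<close>
  have "summable (\<lambda>l. of_real (r l) * (0::quat) ^ l)"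
    by simp
  from le[OF this] have nonneg: "0 \<le> quat_conv_radius r"
    by (simp add: zero_ereal_def)
  show "conv_radius (\<lambda>l. complex_of_real (r l)) \<le> quat_conv_radius r"
  proof (rule ccontr)
    assume "\<not> conv_radius (\<lambda>l. complex_of_real (r l)) \<le> quat_conv_radius r"
    \<comment> \<open>As \<open>c\<close> turns out nonnegative, \<open>of_real c\<close> has norm
      exactly \<open>c\<close>. The series converges there, so \<open>c\<close> cannot exceed the
      supremum.\<close>
    then obtain c where c: "quat_conv_radius r < ereal c"
      "ereal c < conv_radius (\<lambda>l. complex_of_real (r l))"
      by (metis ereal_dense2 not_le)
    with nonneg have "0 \<le> c"
      by (metis ereal_less(2) le_less_trans less_imp_le)
    with c le[of "of_real c"] summable_p[of "of_real c"] show False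
      by simp
  qed
qed

theorem proposition3p13:
  fixes r :: "nat \<Rightarrow> real" and R :: ereal
    and \<psi>C :: "complex \<Rightarrow> complex" and \<psi>H :: "quat \<Rightarrow> quat"
  assumes "conv_radius (\<lambda>l. complex_of_real (r l)) = R"
    and "\<forall>\<xi> \<in> eball 0 R. (\<lambda>l. of_real (r l) * \<xi> ^ l) sums \<psi>C \<xi>"
    and "H_representation (eball 0 R) \<psi>C (eball 0 R) \<psi>H"
  shows "(\<forall>p \<in> eball 0 R. (\<lambda>l. of_real (r l) * p ^ l) sums \<psi>H p) \<and>
         quat_conv_radius r = R"
proof (intro conjI ballI)
  show "quat_conv_radius r = R"
    using assms(1) by (simp add: quat_conv_radius_eq_conv_radius)
next
  fix p :: quat
  assume p: "p \<in> eball 0 R"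
  obtain e where e: "defined_on e (eball (0::complex) R)"
    "\<And>\<xi>. \<xi> \<in> eball 0 R \<Longrightarrow> \<psi>C \<xi> = eval_expr e \<xi>"
    "\<And>p. p \<in> eball 0 R \<Longrightarrow> \<psi>H p = eval_expr e p"
    using assms(3) unfolding H_representation_def by metis
  obtain v \<xi> where v: "v * v = -1" and p_eq: "p = slice v \<xi>" "norm \<xi> = norm p"
    by (rule exists_slice)
  interpret real_div_algebra_hom "slice v"
    using v by (rule real_div_algebra_hom_slice)
  have \<xi>: "\<xi> \<in> eball 0 R"
    using p p_eq(2) by (simp add: in_eball_iff)
  have "(\<lambda>l. slice v (of_real (r l) * \<xi> ^ l)) sums slice v (\<psi>C \<xi>)"
    using assms(2) \<xi> by (intro sums) blast
  \<comment> \<open>Both representations evaluate the same \<open>e\<close>, so the homomorphism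
    \<open>slice v\<close> carries its value at \<open>\<xi>\<close> to its value at
    \<open>p\<close>.\<close>
  moreover have "slice v (\<psi>C \<xi>) = \<psi>H p"
    using hom_eval_expr[OF e(1) \<xi>] e(2)[OF \<xi>] e(3)[OF p] p_eq(1) by simp
  ultimately show "(\<lambda>l. of_real (r l) * p ^ l) sums \<psi>H p"
    by (simp add: slice_power_series_term[OF v] p_eq(1))
qed

end
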